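(* Let $n\ge 0$, $\pi\in S_n(132)$, and let $\phi$ be the map defined below. Then $$\bigl(B(\phi(\pi)),\,A(\phi(\pi)),\,\mathsf{rlmin}(\phi(\pi)),\,\mathsf{rlmax}(\phi(\pi))\bigr)=\bigl(A(\pi),\,B(\pi),\,\mathsf{rlmax}(\pi),\,\mathsf{rlmin}(\pi)\bigr).$$
   Context: $S_n$ is the set of permutations of $\{1,\dots,n\}$ written in one-line notation $\pi=\pi_1\cdots\pi_n$; $S_n(132)$ is the set of those avoiding the classical pattern $132$ (no $i<j<k$ with $\pi_i<\pi_k<\pi_j$). For $\pi\in S_n$: $A(\pi)=\mathrm{card}\{(i,j):1\le i<j\le n-1,\ \pi_{j+1}<\pi_i<\pi_j\}$ (occurrences of the vincular pattern $2\text{-}\underline{31}$, the entries playing $3$ and $1$ adjacent); $B(\pi)=\mathrm{card}\{(i,j):1\le i<j\le n-1,\ \pi_j<\pi_i<\pi_{j+1}\}$ (occurrences of $2\text{-}\underline{13}$); $\mathsf{rlmax}(\pi)$ is the number of $i$ with $\pi_i>\pi_j$ for all $j>i$; $\mathsf{rlmin}(\pi)$ is the number of $i$ with $\pi_i<\pi_j$ for all $j>i$. For permutations $\alpha$ (length $a$), $\beta$ (length $b$): $\alpha\oplus\beta$ has entries $\alpha_i$ ($i\le a$) and $\beta_{i-a}+a$ ($i>a$); $\alpha\ominus\beta$ has entries $\alpha_i+b$ ($i\le a$) and $\beta_{i-a}$ ($i>a$); $1$ is the permutation of length one. Every nonempty $\pi\in S_n(132)$ is uniquely $\pi=\alpha\ominus(\beta\oplus1)$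 with $\alpha,\beta$ (possibly empty) $132$-avoiding. The map $\phi$: $\phi(\varepsilon)=\varepsilon$ for the empty permutation, and $\phi(\alpha\ominus(\beta\oplus1))=\phi(\beta)\ominus(\phi(\alpha)\oplus1)$. *)

theory Defs
  imports "HOL-Combinatorics.Multiset_Permutations"
begin

text \<open>A permutation in one-line notation is a list over \<open>{1..n}\<close>; list positions count from 0.\<close>

definition avoids132 :: "nat list \<Rightarrow> bool" where
  "avoids132 p \<longleftrightarrow>
     \<not> (\<exists>i j k. i < j \<and> j < k \<and> k < length p \<and> p ! i < p ! k \<and> p ! k < p ! j)"

definition S132 :: "nat \<Rightarrow> nat list set" where
  "S132 n = {p \<in> permutations_of_set {1..n}. avoids132 p}"

definition occ_2_31 :: "nat list \<Rightarrow> nat" where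
  "occ_2_31 p =
     card {(i, j). i < j \<and> Suc j < length p \<and> p ! Suc j < p ! i \<and> p ! i < p ! j}"

definition occ_2_13 :: "nat list \<Rightarrow> nat" where
  "occ_2_13 p =
     card {(i, j). i < j \<and> Suc j < length p \<and> p ! j < p ! i \<and> p ! i < p ! Suc j}"

definition rlmax :: "nat list \<Rightarrow> nat" where
  "rlmax p = card {i. i < length p \<and> (\<forall>j. i < j \<and> j < length p \<longrightarrow> p ! i > p ! j)}"

definition rlmin :: "nat list \<Rightarrow> nat" where
  "rlmin p = card {i. i < length p \<and> (\<forall>j. i < j \<and> j < length p \<longrightarrow> p ! i < p ! j)}"

definition direct_sum :: "nat list \<Rightarrow> nat list \<Rightarrow> nat list"  (infixl "\<oplus>" 65) where
  "\<alpha> \<oplus> \<beta> = \<alpha> @ map (\<lambda>x. x + length \<alpha>) \<beta>"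

definition skew_sum :: "nat list \<Rightarrow> nat list \<Rightarrow> nat list"  (infixl "\<ominus>" 65) where
  "\<alpha> \<ominus> \<beta> = map (\<lambda>x. x + length \<beta>) \<alpha> @ \<beta>"

text \<open>If \<open>p = \<alpha> \<ominus> (\<beta> \<oplus> [1])\<close>, then \<open>last p = length \<beta> + 1\<close>, so the first \<open>length p - last p\<close>
  entries of \<open>p\<close> are those of \<open>\<alpha>\<close>, raised by \<open>last p\<close>. Lemmas \<open>decomp132_unique\<close> and \<open>phi_decomp\<close>
  below show that \<open>phi\<close> is the map determined by
  \<open>phi (\<alpha> \<ominus> (\<beta> \<oplus> [1])) = phi \<beta> \<ominus> (phi \<alpha> \<oplus> [1])\<close> on 132-avoiding permutations.
  Its values on other lists are irrelevant.\<close>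

definition left_part :: "nat list \<Rightarrow> nat list" where
  "left_part p = map (\<lambda>x. x - last p) (take (length p - last p) (butlast p))"

definition right_part :: "nat list \<Rightarrow> nat list" where
  "right_part p = drop (length p - last p) (butlast p)"

lemma length_left_part_less: "p \<noteq> [] \<Longrightarrow> length (left_part p) < length p"
  by (cases p rule: rev_cases) (auto simp: left_part_def)

lemma length_right_part_less: "p \<noteq> [] \<Longrightarrow> length (right_part p) < length p"
  by (cases p rule: rev_cases) (auto simp: right_part_def)

function phi :: "nat list \<Rightarrow> nat list" where
  "phi p = (if p = [] then [] else phi (right_part p) \<ominus> (phi (left_part p) \<oplus> [1]))"
  by pat_completeness auto
termination
  by (relation "measure length") (auto simp: length_left_part_less length_right_part_less)

declare phi.simps [simp del]

lemma length_decomp: "length (\<alpha> \<ominus> (\<beta> \<oplus> [1])) = length \<alpha> + length \<beta> + 1"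
  by (simp add: skew_sum_def direct_sum_def)

lemma left_part_decomp: "left_part (\<alpha> \<ominus> (\<beta> \<oplus> [1])) = \<alpha>"
  by (simp add: left_part_def skew_sum_def direct_sum_def butlast_append o_def)

lemma right_part_decomp: "right_part (\<alpha> \<ominus> (\<beta> \<oplus> [1])) = \<beta>"
  by (simp add: right_part_def skew_sum_def direct_sum_def butlast_append)

lemma phi_Nil: "phi [] = []"
  by (simp add: phi.simps)

lemma phi_decomp: "phi (\<alpha> \<ominus> (\<beta> \<oplus> [1])) = phi \<beta> \<ominus> (phi \<alpha> \<oplus> [1])"
  using length_decomp[of \<alpha> \<beta>]
  by (subst phi.simps) (auto simp del: One_nat_def simp: left_part_decomp right_part_decomp)

lemma S132_length: "p \<in> S132 n \<Longrightarrow> length p = n"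
  using length_finite_permutations_of_set[of p "{1..n}"] by (auto simp: S132_def)

lemma avoids132_append:
  assumes "avoids132 (xs @ ys)"
  shows "avoids132 xs" "avoids132 ys"
proof -
  have av: "\<not> ((xs @ ys) ! i < (xs @ ys) ! k \<and> (xs @ ys) ! k < (xs @ ys) ! j)"
    if "i < j" "j < k" "k < length xs + length ys" for i j k
    using assms that unfolding avoids132_def by auto
  show "avoids132 xs"
    unfolding avoids132_def
  proof (intro notI, elim exE conjE)
    fix i j k assume *: "i < j" "j < k" "k < length xs" "xs ! i < xs ! k" "xs ! k < xs ! j"
    then show False using av[of i j k] by (simp add: nth_append)
  qed
  show "avoids132 ys"
    unfolding avoids132_def
  proof (intro notI, elim exE conjE)
    fix i j k assume *: "i < j" "j < k" "k < length ys" "ys ! i < ys ! k" "ys ! k < ys ! j"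
    then show False
      using av[of "length xs + i" "length xs + j" "length xs + k"] by (simp add: nth_append)
  qed
qed

lemma avoids132_shift:
  assumes "avoids132 xs" "\<And>x. x \<in> set xs \<Longrightarrow> k < x"
  shows "avoids132 (map (\<lambda>x. x - k) xs)"
  unfolding avoids132_def
proof (intro notI, elim exE conjE)
  fix i j l
  assume *: "i < j" "j < l" "l < length (map (\<lambda>x. x - k) xs)"
    "map (\<lambda>x. x - k) xs ! i < map (\<lambda>x. x - k) xs ! l"
    "map (\<lambda>x. x - k) xs ! l < map (\<lambda>x. x - k) xs ! j"
  then have "xs ! i < xs ! l" "xs ! l < xs ! j"
    by auto
  then show False using * assms(1) unfolding avoids132_def by auto
qed

lemma avoids132_snoc_split:
  assumes "avoids132 (q @ [k])" "k \<notin> set q"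
  shows "\<exists>xs ys. q = xs @ ys \<and> (\<forall>x\<in>set xs. k < x) \<and> (\<forall>y\<in>set ys. y < k)"
proof (intro exI conjI)
  let ?P = "\<lambda>x. k < x"
  show "q = takeWhile ?P q @ dropWhile ?P q" by simp
  show "\<forall>x\<in>set (takeWhile ?P q). k < x" by (auto dest: set_takeWhileD)
  show "\<forall>y\<in>set (dropWhile ?P q). y < k"
  proof (cases "dropWhile ?P q")
    case (Cons z zs)
    have "z \<in> set q" using Cons by (metis list.set_intros(1) set_dropWhileD)
    then have z: "z < k"
      using Cons assms(2) by (metis dropWhile_eq_Cons_conv linorder_neqE_nat)
    have "avoids132 (takeWhile ?P q @ (z # zs @ [k]))"
      using assms(1) Cons by (metis append.assoc append_Cons takeWhile_dropWhile_id)
    then have av: "avoids132 (z # zs @ [k])" by (rule avoids132_append)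
    have "y < k" if ymem: "y \<in> set zs" for y
    proof (rule ccontr)
      assume "\<not> y < k"
      moreover have "y \<in> set q" using ymem Cons by (metis list.set_intros(2) set_dropWhileD)
      ultimately have "k < y" using assms(2) by (metis linorder_neqE_nat)
      obtain m where "m < length zs" "zs ! m = y" using ymem by (auto simp: in_set_conv_nth)
      then show False
        using av[unfolded avoids132_def] z \<open>k < y\<close>
        by (elim notE, intro exI[of _ 0] exI[of _ "Suc m"] exI[of _ "Suc (length zs)"])
           (simp add: nth_append)
    qed
    then show ?thesis using z Cons by auto
  next
    case Nil
    then show ?thesis by (simp only: list.set ball_empty)
  qed
qed

lemma decomp132_unique:
  assumes "p \<in> S132 n" "p \<noteq> []"
  shows "\<exists>!(\<alpha>, \<beta>). \<alpha> \<in> S132 (length \<alpha>) \<and> \<beta> \<in> S132 (length \<beta>) \<and> p = \<alpha> \<ominus> (\<beta> \<oplus> [1])"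
proof -
  obtain q k where p: "p = q @ [k]" using assms(2) by (cases p rule: rev_cases) auto
  have set_p: "set p = {1..n}" and dist: "distinct p" and av: "avoids132 p"
    using assms(1) by (auto simp: S132_def permutations_of_set_def)
  obtain xs ys where q: "q = xs @ ys" and xs: "\<forall>x\<in>set xs. k < x" and ys: "\<forall>y\<in>set ys. y < k"
    using avoids132_snoc_split[of q k] av dist p by auto
  have k: "k \<in> {1..n}" using set_p p by auto
  have mem: "x \<in> set xs \<or> x \<in> set ys \<or> x = k \<longleftrightarrow> x \<in> {1..n}" for x
  proof -
    have "set p = set xs \<union> set ys \<union> {k}" by (simp add: p q)
    then show ?thesis using set_p by blast
  qed
  have set_xs: "set xs = {k+1..n}"
  proof (intro set_eqI)
    fix x
    have "x \<in> set xs \<Longrightarrow> k < x" "x \<in> set ys \<Longrightarrow> x < k" using xs ys by blast+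
    then show "x \<in> set xs \<longleftrightarrow> x \<in> {k+1..n}"
      using mem[of x] k unfolding atLeastAtMost_iff by linarith
  qed
  have set_ys: "set ys = {1..k-1}"
  proof (intro set_eqI)
    fix x
    have "x \<in> set xs \<Longrightarrow> k < x" "x \<in> set ys \<Longrightarrow> x < k" using xs ys by blast+
    then show "x \<in> set ys \<longleftrightarrow> x \<in> {1..k-1}"
      using mem[of x] k unfolding atLeastAtMost_iff by linarith
  qed
  have dxs: "distinct xs" and dys: "distinct ys" using dist p q by auto
  have lx: "length xs = n - k" using distinct_card[OF dxs] set_xs by simp
  have ly: "length ys = k - 1" using distinct_card[OF dys] set_ys by simp
  define \<alpha> where "\<alpha> = map (\<lambda>x. x - k) xs"
  have la: "length \<alpha> = n - k" by (simp add: \<alpha>_def lx)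
  have avx: "avoids132 xs" "avoids132 ys"
    using av p q avoids132_append[of q "[k]"] avoids132_append[of xs ys] by auto
  have "set \<alpha> = {1..n-k}"
  proof -
    have "set \<alpha> = (\<lambda>x. x - k) ` {k+1..n}" by (simp add: \<alpha>_def set_xs)
    also have "\<dots> = {1..n-k}"
    proof (intro set_eqI iffI)
      fix x assume "x \<in> {1..n-k}"
      then show "x \<in> (\<lambda>x. x - k) ` {k+1..n}" by (intro image_eqI[of _ _ "x + k"]) auto
    qed auto
    finally show ?thesis .
  qed
  moreover have "distinct \<alpha>"
  proof -
    have "inj_on (\<lambda>x. x - k) (set xs)"
      using set_xs by (intro inj_on_diff_nat) auto
    then show ?thesis using dxs by (simp add: \<alpha>_def distinct_map)
  qed
  ultimately have a: "\<alpha> \<in> S132 (length \<alpha>)"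
    using avoids132_shift[OF avx(1)] xs la by (auto simp: S132_def permutations_of_set_def \<alpha>_def)
  have b: "ys \<in> S132 (length ys)"
    using avx set_ys dys ly by (auto simp: S132_def permutations_of_set_def)
  have "map (\<lambda>x. x + k) \<alpha> = xs" using xs by (auto simp: \<alpha>_def o_def intro!: map_idI)
  then have eq: "p = \<alpha> \<ominus> (ys \<oplus> [1])"
    using k by (simp add: p q skew_sum_def direct_sum_def ly)
  show ?thesis
  proof (rule ex1I[of _ "(\<alpha>, ys)"])
    show "case (\<alpha>, ys) of (\<alpha>, \<beta>) \<Rightarrow>
      \<alpha> \<in> S132 (length \<alpha>) \<and> \<beta> \<in> S132 (length \<beta>) \<and> p = \<alpha> \<ominus> (\<beta> \<oplus> [1])"
      using a b eq by simp
  next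
    fix x
    assume "case x of (\<alpha>, \<beta>) \<Rightarrow>
      \<alpha> \<in> S132 (length \<alpha>) \<and> \<beta> \<in> S132 (length \<beta>) \<and> p = \<alpha> \<ominus> (\<beta> \<oplus> [1])"
    then obtain \<alpha>' \<beta>' where x: "x = (\<alpha>', \<beta>')" and eq': "p = \<alpha>' \<ominus> (\<beta>' \<oplus> [1])"
      by (cases x) simp
    have "\<alpha>' = \<alpha>" using eq eq' left_part_decomp by metis
    moreover have "\<beta>' = ys" using eq eq' right_part_decomp by metis
    ultimately show "x = (\<alpha>, ys)" using x by simp
  qed
qed

end

theory Submission
  imports Defs
begin

text \<open>For \<open>\<pi> = \<alpha> \<ominus> (\<beta> \<oplus> [1])\<close> the only occurrences of the two vincular patterns that do not lie inside
  \<open>\<alpha>\<close> or \<open>\<beta>\<close> use the descent leaving \<open>\<alpha>\<close> or the ascent into the final entry, so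
  \<open>A(\<pi>) = A(\<alpha>) + A(\<beta>) + (last \<alpha> - 1)\<close> and \<open>B(\<pi>) = B(\<alpha>) + B(\<beta>) + (length \<beta> - last \<beta>)\<close>,
  the last summand being absent if \<open>\<alpha>\<close>, respectively \<open>\<beta>\<close>, is empty. Similarly
  \<open>rlmax \<pi> = rlmax \<alpha> + 1\<close> and \<open>rlmin \<pi> = rlmin \<beta> + 1\<close>. Since \<open>last \<pi> = length \<beta> + 1\<close>, the map \<open>phi\<close>
  satisfies \<open>last \<pi> + last (phi \<pi>) = length \<pi> + 1\<close>, which exchanges the two boundary terms,
  and the theorem follows by induction.\<close>

section \<open>Pattern counts and right-to-left records for an arbitrary relation\<close>

definition vincular_count :: "('a \<Rightarrow> 'a \<Rightarrow> 'a \<Rightarrow> bool) \<Rightarrow> 'a list \<Rightarrow> nat" where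
  "vincular_count R p =
     card {(i, j). i < j \<and> Suc j < length p \<and> R (p ! i) (p ! j) (p ! Suc j)}"

definition rl_count :: "('a \<Rightarrow> 'a \<Rightarrow> bool) \<Rightarrow> 'a list \<Rightarrow> nat" where
  "rl_count R p = card {i. i < length p \<and> (\<forall>j. i < j \<and> j < length p \<longrightarrow> R (p ! i) (p ! j))}"

lemma occ_2_31_eq: "occ_2_31 = vincular_count (\<lambda>x y z. z < x \<and> x < y)"
  by (simp add: fun_eq_iff occ_2_31_def vincular_count_def)

lemma occ_2_13_eq: "occ_2_13 = vincular_count (\<lambda>x y z. y < x \<and> x < z)"
  by (simp add: fun_eq_iff occ_2_13_def vincular_count_def)

lemma rlmax_eq: "rlmax = rl_count (\<lambda>x y. x > y)"
  by (simp add: fun_eq_iff rlmax_def rl_count_def)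

lemma rlmin_eq: "rlmin = rl_count (<)"
  by (simp add: fun_eq_iff rlmin_def rl_count_def)

lemma vincular_count_Nil [simp]: "vincular_count R [] = 0"
  by (simp add: vincular_count_def)

text \<open>The only new adjacent pair is \<open>last xs\<close>, \<open>y\<close>, so a new
  occurrence is determined by its first letter, which lies in \<open>butlast xs\<close>.\<close>

lemma vincular_count_snoc:
  "vincular_count R (xs @ [y]) = vincular_count R xs +
     (if xs = [] then 0 else length (filter (\<lambda>z. R z (last xs) y) (butlast xs)))"
proof (cases xs rule: rev_cases)
  case Nil
  then show ?thesis by (simp add: vincular_count_def)
next
  case (snoc us x)
  let ?p = "us @ [x, y]"
  let ?A = "{(i, j). i < j \<and> Suc j < length xs \<and> R (xs ! i) (xs ! j) (xs ! Suc j)}"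
  let ?I = "{i. i < length us \<and> R (us ! i) x y}"
  \<comment> \<open>With positions counted from 0, \<open>length us\<close> is the position of
    \<open>x\<close>; the pairs with this \<open>j\<close> are the new ones.\<close>
  have "{(i, j). i < j \<and> Suc j < length ?p \<and> R (?p ! i) (?p ! j) (?p ! Suc j)}
      = ?A \<union> (\<lambda>i. (i, length us)) ` ?I" (is "?L = _")
  proof (intro equalityI subsetI)
    fix q assume "q \<in> ?L"
    then obtain i j where q: "q = (i, j)" "i < j" "j \<le> length us"
        "R (?p ! i) (?p ! j) (?p ! Suc j)"
      by auto
    then show "q \<in> ?A \<union> (\<lambda>i. (i, length us)) ` ?I"
      by (cases "j = length us") (auto simp: snoc nth_append less_Suc_eq)
  next
    fix q assume "q \<in> ?A \<union> (\<lambda>i. (i, length us)) ` ?I"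
    then show "q \<in> ?L"
    proof
      assume "q \<in> ?A"
      then obtain i j where "q = (i, j)" "i < j" "j < length us"
          "R (xs ! i) (xs ! j) (xs ! Suc j)"
        by (auto simp: snoc)
      then show ?thesis by (cases "Suc j = length us") (auto simp: snoc nth_append)
    next
      assume "q \<in> (\<lambda>i. (i, length us)) ` ?I"
      then show ?thesis by (auto simp: nth_append)
    qed
  qed
  moreover have "finite ?A"
    by (rule finite_subset[of _ "{..length xs} \<times> {..length xs}"]) auto
  moreover have "?A \<inter> (\<lambda>i. (i, length us)) ` ?I = {}"
    by (auto simp: snoc)
  moreover have "card ((\<lambda>i. (i, length us)) ` ?I) = card ?I"
    by (rule card_image) (auto simp: inj_on_def)
  ultimately show ?thesis
    by (simp add: vincular_count_def snoc length_filter_conv_card card_Un_disjoint)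
qed

text \<open>Each letter of \<open>ys\<close> after the first forms its adjacent pair inside
  \<open>ys\<close>, where the hypothesis forbids a first letter from \<open>xs\<close>. Hence
  \<open>ys\<close> interacts with \<open>xs\<close> only through the adjacency at
  \<open>hd ys\<close>.\<close>

lemma vincular_count_append:
  assumes "ys \<noteq> []" "\<And>x y z. x \<in> set xs \<Longrightarrow> y \<in> set ys \<Longrightarrow> z \<in> set ys \<Longrightarrow> \<not> R x y z"
  shows "vincular_count R (xs @ ys) = vincular_count R (xs @ [hd ys]) + vincular_count R ys"
  using assms
proof (induction ys rule: rev_induct)
  case (snoc z ys)
  show ?case
  proof (cases "ys = []")
    case True
    then show ?thesis using vincular_count_snoc[of R "[]" z] by simp
  next
    case False
    then have "filter (\<lambda>u. R u (last ys) z) xs = []"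
      using snoc.prems by (auto simp: filter_empty_conv)
    then show ?thesis
      using snoc False vincular_count_snoc[of R "xs @ ys" z] vincular_count_snoc[of R ys z]
      by (simp add: butlast_append)
  qed
qed simp

lemma vincular_count_map:
  assumes "\<And>x y z. R (f x) (f y) (f z) \<longleftrightarrow> R x y z"
  shows "vincular_count R (map f xs) = vincular_count R xs"
  unfolding vincular_count_def using assms
  by (intro arg_cong[of _ _ card]) auto

lemma rl_count_Nil [simp]: "rl_count R [] = 0"
  by (simp add: rl_count_def)

text \<open>Whether a position counts depends only on the suffix starting there, so prepending a
  letter leaves the other positions unaffected.\<close>

lemma rl_count_Cons:
  "rl_count R (x # xs) = rl_count R xs + (if \<forall>y\<in>set xs. R x y then 1 else 0)"
proof -
  let ?I = "\<lambda>p. {i. i < length p \<and> (\<forall>j. i < j \<and> j < length p \<longrightarrow> R (p ! i) (p ! j))}"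
  have "?I (x # xs) = Suc ` ?I xs \<union> (if \<forall>y\<in>set xs. R x y then {0} else {})" (is "_ = ?B")
  proof (intro set_eqI)
    fix i
    show "i \<in> ?I (x # xs) \<longleftrightarrow> i \<in> ?B"
    proof (cases i)
      case 0
      then show ?thesis by (auto simp: all_set_conv_all_nth gr0_conv_Suc)
    next
      case (Suc k)
      then have "i \<in> ?I (x # xs) \<longleftrightarrow> k \<in> ?I xs"
        by (auto simp: less_Suc_eq_0_disj)
      then show ?thesis using Suc by auto
    qed
  qed
  moreover have "card (Suc ` ?I xs) = card (?I xs)"
    by (rule card_image) auto
  ultimately show ?thesis
    by (auto simp: rl_count_def card_insert_if)
qed

lemma rl_count_append_all:
  assumes "\<And>x y. x \<in> set xs \<Longrightarrow> y \<in> set ys \<Longrightarrow> R x y"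
  shows "rl_count R (xs @ ys) = rl_count R xs + rl_count R ys"
  using assms by (induction xs) (auto simp: rl_count_Cons)

lemma rl_count_append_none:
  assumes "\<And>x. x \<in> set xs \<Longrightarrow> \<exists>y\<in>set ys. \<not> R x y"
  shows "rl_count R (xs @ ys) = rl_count R ys"
  using assms by (induction xs) (auto simp: rl_count_Cons)

lemma rl_count_map:
  assumes "\<And>x y. R (f x) (f y) \<longleftrightarrow> R x y"
  shows "rl_count R (map f xs) = rl_count R xs"
  using assms by (induction xs) (auto simp: rl_count_Cons)

section \<open>Permutations and the shape of the decomposition\<close>

text \<open>This notion is applied both to the summands of a 132-avoiding permutation and to their
  images under \<open>phi\<close>.\<close>

definition one_line :: "nat list \<Rightarrow> bool" where
  "one_line p \<longleftrightarrow> distinct p \<and> set p = {1..length p}"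

lemma one_line_Nil: "one_line []"
  by (simp add: one_line_def)

lemma S132_one_line: "p \<in> S132 n \<Longrightarrow> one_line p"
  using S132_length[of p n] by (auto simp: S132_def permutations_of_set_def one_line_def)

text \<open>The flat form shows three blocks: the raised \<alpha> on top in value, \<beta> at the
  bottom, and the final letter between them.\<close>

lemma skew_sum_snoc:
  "\<alpha> \<ominus> (\<beta> \<oplus> [1]) = map (\<lambda>x. x + Suc (length \<beta>)) \<alpha> @ \<beta> @ [Suc (length \<beta>)]"
  by (simp add: skew_sum_def direct_sum_def)

lemma last_decomp: "last (\<alpha> \<ominus> (\<beta> \<oplus> [1])) = Suc (length \<beta>)"
  unfolding skew_sum_snoc by simp

lemma one_line_decomp:
  assumes "one_line \<alpha>" "one_line \<beta>"
  shows "one_line (\<alpha> \<ominus> (\<beta> \<oplus> [1]))"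
proof -
  have "(\<lambda>x. x + Suc (length \<beta>)) ` {1..length \<alpha>}
      = {Suc (Suc (length \<beta>))..length \<alpha> + Suc (length \<beta>)}"
    using image_add_atLeastAtMost[of "Suc (length \<beta>)" 1 "length \<alpha>"] by (simp add: add.commute)
  then show ?thesis
    using assms unfolding skew_sum_snoc by (auto simp: one_line_def distinct_map inj_on_def)
qed

text \<open>The smaller values are \<open>1\<close> to \<open>last p - 1\<close>, and all of them
  precede the last position. This count becomes the boundary term of 2-31.\<close>

lemma one_line_butlast_less:
  assumes "one_line p" "p \<noteq> []"
  shows "length (filter (\<lambda>x. x < last p) (butlast p)) = last p - 1"
proof (cases p rule: rev_cases)
  case (snoc xs x)
  have x: "x \<in> {1..length p}" "x \<notin> set xs" "distinct xs" and
    s: "insert x (set xs) = {1..length p}"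
    using assms by (auto simp: snoc one_line_def)
  have "{z \<in> set xs. z < x} = {z \<in> {1..length p}. z < x}"
    unfolding s[symmetric] using x by auto
  also have "\<dots> = {1..<x}" using x by auto
  finally show ?thesis
    using x distinct_card[of "filter (\<lambda>z. z < x) xs"] by (simp add: snoc)
qed (use assms in simp)

text \<open>The mirror count, over the values above \<open>last p\<close>, becomes the boundary term
  of 2-13.\<close>

lemma one_line_butlast_greater:
  assumes "one_line p" "p \<noteq> []"
  shows "length (filter (\<lambda>x. last p < x) (butlast p)) = length p - last p"
proof (cases p rule: rev_cases)
  case (snoc xs x)
  have x: "x \<in> {1..length p}" "x \<notin> set xs" "distinct xs" and
    s: "insert x (set xs) = {1..length p}"
    using assms by (auto simp: snoc one_line_def)
  have "{z \<in> set xs. x < z} = {z \<in> {1..length p}. x < z}"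
    unfolding s[symmetric] using x by auto
  also have "\<dots> = {x<..length p}" using x by auto
  finally show ?thesis
    using x distinct_card[of "filter (\<lambda>z. x < z) xs"] by (simp add: snoc)
qed (use assms in simp)

section \<open>The four statistics on a decomposed permutation\<close>

context
  fixes \<alpha> \<beta> :: "nat list"
  assumes \<alpha>: "one_line \<alpha>" and \<beta>: "one_line \<beta>"
begin

lemma bounds:
  "x \<in> set \<alpha> \<Longrightarrow> 1 \<le> x \<and> x \<le> length \<alpha>" "y \<in> set \<beta> \<Longrightarrow> 1 \<le> y \<and> y \<le> length \<beta>"
  using \<alpha> \<beta> by (auto simp: one_line_def)

text \<open>The letter following the raised \<alpha>, whether or not \<beta> is empty, thus lies
  below all raised letters.\<close>

lemma hd_snoc_le: "hd (\<beta> @ [Suc (length \<beta>)]) \<le> Suc (length \<beta>)"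
  using bounds(2)[of "hd \<beta>"] by (cases \<beta>) auto

lemma occ_2_31_decomp:
  "occ_2_31 (\<alpha> \<ominus> (\<beta> \<oplus> [1])) =
     occ_2_31 \<alpha> + occ_2_31 \<beta> + (if \<alpha> = [] then 0 else last \<alpha> - 1)"
proof -
  let ?R = "\<lambda>x y z :: nat. z < x \<and> x < y"
  let ?f = "\<lambda>x. x + Suc (length \<beta>)"
  let ?c = "hd (\<beta> @ [Suc (length \<beta>)])"
  \<comment> \<open>A raised letter exceeds everything after the block of \<alpha>, so its value
    cannot lie between two letters found there.\<close>
  have "vincular_count ?R (map ?f \<alpha> @ \<beta> @ [Suc (length \<beta>)])
      = vincular_count ?R (map ?f \<alpha> @ [?c]) + vincular_count ?R (\<beta> @ [Suc (length \<beta>)])"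
    by (intro vincular_count_append) (auto dest: bounds)
  moreover have "vincular_count ?R (\<beta> @ [Suc (length \<beta>)]) = vincular_count ?R \<beta>"
  proof -
    \<comment> \<open>The final letter exceeds all of \<beta>, so it cannot play the 1.\<close>
    have "filter (\<lambda>x. Suc (length \<beta>) < x \<and> x < last \<beta>) (butlast \<beta>) = []"
      by (auto simp: filter_empty_conv dest!: in_set_butlastD bounds(2))
    then show ?thesis by (simp add: vincular_count_snoc)
  qed
  moreover have "vincular_count ?R (map ?f \<alpha> @ [?c])
      = vincular_count ?R \<alpha> + (if \<alpha> = [] then 0 else last \<alpha> - 1)"
  proof -
    \<comment> \<open>Since \<open>?c\<close> lies below every raised letter, only the comparison
      with \<open>last \<alpha>\<close> remains.\<close>
    have "filter (\<lambda>x. ?c < ?f x \<and> ?f x < ?f (last \<alpha>)) (butlast \<alpha>)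
        = filter (\<lambda>x. x < last \<alpha>) (butlast \<alpha>)"
      using hd_snoc_le by (intro filter_cong) (auto dest!: in_set_butlastD bounds)
    then have "length (filter (\<lambda>x. ?c < ?f x \<and> ?f x < ?f (last \<alpha>)) (butlast \<alpha>)) = last \<alpha> - 1"
      if "\<alpha> \<noteq> []"
      using one_line_butlast_less[OF \<alpha> that] by simp
    then show ?thesis
      by (simp add: vincular_count_snoc vincular_count_map last_map map_butlast[symmetric]
          filter_map o_def del: add_Suc_right)
  qed
  ultimately show ?thesis unfolding occ_2_31_eq skew_sum_snoc by simp
qed

lemma occ_2_13_decomp:
  "occ_2_13 (\<alpha> \<ominus> (\<beta> \<oplus> [1])) =
     occ_2_13 \<alpha> + occ_2_13 \<beta> + (if \<beta> = [] then 0 else length \<beta> - last \<beta>)"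
proof -
  let ?R = "\<lambda>x y z :: nat. y < x \<and> x < z"
  let ?f = "\<lambda>x. x + Suc (length \<beta>)"
  let ?c = "hd (\<beta> @ [Suc (length \<beta>)])"
  have "vincular_count ?R (map ?f \<alpha> @ \<beta> @ [Suc (length \<beta>)])
      = vincular_count ?R (map ?f \<alpha> @ [?c]) + vincular_count ?R (\<beta> @ [Suc (length \<beta>)])"
    by (intro vincular_count_append) (auto dest: bounds)
  moreover have "vincular_count ?R (map ?f \<alpha> @ [?c]) = vincular_count ?R \<alpha>"
  proof -
    \<comment> \<open>No raised letter lies below \<open>?c\<close>: the step out of \<alpha> is a
      descent and cannot play 13.\<close>
    have "filter (\<lambda>x. ?f (last \<alpha>) < ?f x \<and> ?f x < ?c) (butlast \<alpha>) = []"
      using hd_snoc_le by (auto simp: filter_empty_conv)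
    then show ?thesis
      by (simp add: vincular_count_snoc vincular_count_map last_map map_butlast[symmetric]
          filter_map o_def del: add_Suc_right)
  qed
  moreover have "vincular_count ?R (\<beta> @ [Suc (length \<beta>)])
      = vincular_count ?R \<beta> + (if \<beta> = [] then 0 else length \<beta> - last \<beta>)"
  proof -
    \<comment> \<open>The final letter exceeds all of \<beta>, so the upper bound on
      \<open>x\<close> is automatic.\<close>
    have "filter (\<lambda>x. last \<beta> < x \<and> x < Suc (length \<beta>)) (butlast \<beta>)
        = filter (\<lambda>x. last \<beta> < x) (butlast \<beta>)"
      by (intro filter_cong) (auto dest!: in_set_butlastD bounds)
    then show ?thesis
      using one_line_butlast_greater[OF \<beta>] by (simp add: vincular_count_snoc)
  qed
  ultimately show ?thesis unfolding occ_2_13_eq skew_sum_snoc by simp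
qed

text \<open>Letters of \<alpha> exceed everything after their block and keep their status; the final
  letter disqualifies all of \<beta> and itself adds one.\<close>

lemma rlmax_decomp: "rlmax (\<alpha> \<ominus> (\<beta> \<oplus> [1])) = Suc (rlmax \<alpha>)"
proof -
  let ?k = "Suc (length \<beta>)"
  have "rlmax (\<alpha> \<ominus> (\<beta> \<oplus> [1])) = rlmax (map (\<lambda>x. x + ?k) \<alpha>) + rlmax (\<beta> @ [?k])"
    unfolding rlmax_eq skew_sum_snoc
    by (rule rl_count_append_all) (auto dest: bounds)
  moreover have "rlmax (\<beta> @ [?k]) = rlmax [?k]"
    unfolding rlmax_eq by (rule rl_count_append_none) (auto dest: bounds)
  ultimately show ?thesis
    by (simp add: rlmax_eq rl_count_map rl_count_Cons)
qed

text \<open>The final letter lies below all raised letters, which disqualifies \<alpha>, but above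
  all of \<beta>, whose minima survive.\<close>

lemma rlmin_decomp: "rlmin (\<alpha> \<ominus> (\<beta> \<oplus> [1])) = Suc (rlmin \<beta>)"
proof -
  let ?k = "Suc (length \<beta>)"
  have "rlmin (\<alpha> \<ominus> (\<beta> \<oplus> [1])) = rlmin (\<beta> @ [?k])"
    unfolding rlmin_eq skew_sum_snoc
    by (rule rl_count_append_none) auto
  also have "\<dots> = rlmin \<beta> + rlmin [?k]"
    unfolding rlmin_eq by (rule rl_count_append_all) (auto dest: bounds)
  finally show ?thesis
    by (simp add: rlmin_eq rl_count_Cons)
qed

end

section \<open>Induction along the decomposition\<close>

text \<open>This follows the recursion of \<open>phi\<close>: \<open>decomp132_unique\<close>
  supplies the summands, and both are shorter than \<open>p\<close>.\<close>

lemma S132_induct [consumes 1, case_names Nil decomp]: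
  assumes "p \<in> S132 n" "P []"
    and "\<And>\<alpha> \<beta>. \<alpha> \<in> S132 (length \<alpha>) \<Longrightarrow> \<beta> \<in> S132 (length \<beta>) \<Longrightarrow> P \<alpha> \<Longrightarrow> P \<beta> \<Longrightarrow>
      P (\<alpha> \<ominus> (\<beta> \<oplus> [1]))"
  shows "P p"
  using assms(1)
proof (induction p arbitrary: n rule: length_induct)
  case (1 p)
  show ?case
  proof (cases "p = []")
    case False
    then obtain \<alpha> \<beta> where d: "\<alpha> \<in> S132 (length \<alpha>)" "\<beta> \<in> S132 (length \<beta>)" "p = \<alpha> \<ominus> (\<beta> \<oplus> [1])"
      using decomp132_unique[OF 1(2)] by auto
    then have "length \<alpha> < length p" "length \<beta> < length p"
      by (simp_all add: length_decomp del: One_nat_def)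
    then have "P \<alpha>" "P \<beta>" using 1(1) d(1,2) by blast+
    then show ?thesis using assms(3) d by blast
  qed (use assms(2) in simp)
qed

lemma length_phi: "p \<in> S132 n \<Longrightarrow> length (phi p) = length p"
  by (induction rule: S132_induct) (simp_all add: phi_Nil phi_decomp length_decomp del: One_nat_def)

lemma one_line_phi: "p \<in> S132 n \<Longrightarrow> one_line (phi p)"
  by (induction rule: S132_induct)
    (simp_all add: phi_Nil phi_decomp one_line_Nil one_line_decomp del: One_nat_def)

text \<open>The last letter is one more than the length of the second summand; \<open>phi\<close>
  swaps the summands and preserves their lengths, so the two last letters see
  \<open>length \<beta>\<close> and \<open>length \<alpha>\<close>.\<close>

lemma last_phi:
  assumes "p \<in> S132 n" "p \<noteq> []"
  shows "last p + last (phi p) = Suc (length p)"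
  using assms
  by (induction rule: S132_induct)
    (simp_all add: phi_decomp last_decomp length_decomp length_phi del: One_nat_def)

theorem theorem1:
  fixes n :: nat and \<pi> :: "nat list"
  assumes "\<pi> \<in> S132 n"
  shows "(occ_2_13 (phi \<pi>), occ_2_31 (phi \<pi>), rlmin (phi \<pi>), rlmax (phi \<pi>))
       = (occ_2_31 \<pi>, occ_2_13 \<pi>, rlmax \<pi>, rlmin \<pi>)"
  using assms
proof (induction rule: S132_induct)
  case Nil
  show ?case
    by (simp add: phi_Nil occ_2_13_eq occ_2_31_eq rlmin_eq rlmax_eq)
next
  case (decomp \<alpha> \<beta>)
  note one = S132_one_line[OF decomp(1)] S132_one_line[OF decomp(2)]
    one_line_phi[OF decomp(1)] one_line_phi[OF decomp(2)]
  note len = length_phi[OF decomp(1)] length_phi[OF decomp(2)]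
  \<comment> \<open>The boundary terms vanish on empty summands, so \<open>phi\<close> must preserve
    emptiness for them to match.\<close>
  have Nil_iff: "phi \<alpha> = [] \<longleftrightarrow> \<alpha> = []" "phi \<beta> = [] \<longleftrightarrow> \<beta> = []"
    using len by (metis length_0_conv)+
  \<comment> \<open>In the image \<open>phi \<alpha>\<close> is the second summand and gives the
    2-13 boundary term; \<open>phi \<beta>\<close> is the first and gives the 2-31 term.\<close>
  have "length (phi \<alpha>) - last (phi \<alpha>) = last \<alpha> - 1" if "\<alpha> \<noteq> []"
    using last_phi[OF decomp(1) that] len by simp
  moreover have "last (phi \<beta>) - 1 = length \<beta> - last \<beta>" if "\<beta> \<noteq> []"
    using last_phi[OF decomp(2) that] by simp
  ultimately show ?case
    using decomp(3,4) one Nil_iff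
    by (simp add: phi_decomp occ_2_13_decomp occ_2_31_decomp rlmax_decomp rlmin_decomp
        del: One_nat_def)
qed

end
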